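(* For every integer $k\ge 2$ we have $\tau_k^{(\mathrm{s})}\le \dfrac{3\log k}{k}$.
   Context: A set $A\subset\mathbb{Z}_{>1}$ of integers greater than $1$ is called strongly $k$-primitive if no member of $A$ divides the product of $k$ other members of $A$ which are not necessarily distinct from each other (i.e. there are no $a\in A$ and $a_1,\dots,a_k\in A\setminus\{a\}$, repetitions allowed, with $a\mid a_1\cdots a_k$). The critical exponent $\tau_k^{(\mathrm{s})}$ is the real number such that, for real $\lambda$, the inequality $$\sum_{\substack{n\in A\\ n\le x}} n^{-\lambda}\le \sum_{\substack{p\le x\\ p\text{ prime}}} p^{-\lambda}$$ holds for all strongly $k$-primitive sets $A$ and all $x>1$ if and only if $\lambda\ge\tau_k^{(\mathrm{s})}$. $\log$ is the natural logarithm. *)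

theory Defs
  imports "HOL-Analysis.Analysis" "HOL-Computational_Algebra.Primes"
begin

definition strongly_primitive :: "nat \<Rightarrow> nat set \<Rightarrow> bool" where
  "strongly_primitive k A \<longleftrightarrow>
     (\<forall>a\<in>A. a > 1) \<and>
     \<not> (\<exists>a\<in>A. \<exists>bs. length bs = k \<and> set bs \<subseteq> A - {a} \<and> a dvd prod_list bs)"

definition prime_sum_dominates :: "nat \<Rightarrow> real \<Rightarrow> bool" where
  "prime_sum_dominates k lam \<longleftrightarrow>
     (\<forall>A. strongly_primitive k A \<longrightarrow>
        (\<forall>x::real. x > 1 \<longrightarrow>
           (\<Sum>n\<in>{n\<in>A. real n \<le> x}. real n powr (-lam))
             \<le> (\<Sum>p\<in>{p::nat. prime p \<and> real p \<le> x}. real p powr (-lam))))"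

text \<open>The lemma \<open>strong_critical_exponent_iff\<close> at the end of this theory shows that the
  description below is satisfied, by exactly one real number, for every positive \<open>k\<close>.\<close>

definition strong_critical_exponent :: "nat \<Rightarrow> real" where
  "strong_critical_exponent k =
     (THE t. \<forall>lam. prime_sum_dominates k lam \<longleftrightarrow> lam \<ge> t)"

definition excess :: "nat set \<Rightarrow> nat \<Rightarrow> real \<Rightarrow> real" where
  "excess A m lam = (\<Sum>n\<le>m. (of_bool (n \<in> A) - of_bool (prime n)) * real n powr (-lam))"

lemma excess_eq:
  "(\<Sum>n\<in>{n\<in>A. n \<le> m}. real n powr (-lam))
     - (\<Sum>p\<in>{p. prime p \<and> p \<le> m}. real p powr (-lam)) = excess A m lam"
proof -
  have e: "(\<Sum>n\<in>{n. P n \<and> n \<le> m}. real n powr (-lam))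
             = (\<Sum>n\<le>m. of_bool (P n) * real n powr (-lam))" for P
  proof -
    have "(\<Sum>n\<in>{n. P n \<and> n \<le> m}. real n powr (-lam)) = (\<Sum>n\<in>{n\<in>{..m}. P n}. real n powr (-lam))"
      by (rule sum.cong) auto
    also have "\<dots> = (\<Sum>n\<le>m. if P n then real n powr (-lam) else 0)"
      by (rule sum.inter_filter) simp
    also have "\<dots> = (\<Sum>n\<le>m. of_bool (P n) * real n powr (-lam))"
      by (rule sum.cong) auto
    finally show ?thesis .
  qed
  show ?thesis
    unfolding excess_def e left_diff_distrib sum_subtractf by simp
qed

lemma prime_sum_dominates_iff:
  "prime_sum_dominates k lam \<longleftrightarrow> (\<forall>A. strongly_primitive k A \<longrightarrow> (\<forall>m. excess A m lam \<le> 0))"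
proof (intro iffI allI impI)
  fix A m
  assume d: "prime_sum_dominates k lam" and A: "strongly_primitive k A"
  show "excess A m lam \<le> 0"
  proof (cases "m > 1")
    case True
    then have "real m > 1" by simp
    with d A have "(\<Sum>n\<in>{n\<in>A. real n \<le> real m}. real n powr (-lam))
        \<le> (\<Sum>p\<in>{p::nat. prime p \<and> real p \<le> real m}. real p powr (-lam))"
      unfolding prime_sum_dominates_def by blast
    then show ?thesis by (simp add: excess_eq[symmetric])
  next
    case False
    have e: "{n\<in>A. n \<le> m} = {}" using A False unfolding strongly_primitive_def by fastforce
    show ?thesis unfolding excess_eq[symmetric] e by (simp add: sum_nonneg)
  qed
next
  assume d: "\<forall>A. strongly_primitive k A \<longrightarrow> (\<forall>m. excess A m lam \<le> 0)"
  show "prime_sum_dominates k lam"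
    unfolding prime_sum_dominates_def
  proof (intro allI impI)
    fix A and x :: real
    assume A: "strongly_primitive k A" and x: "x > 1"
    have *: "real n \<le> x \<longleftrightarrow> n \<le> nat \<lfloor>x\<rfloor>" for n
      using x by linarith
    have "excess A (nat \<lfloor>x\<rfloor>) lam \<le> 0" using d A by blast
    then show "(\<Sum>n\<in>{n\<in>A. real n \<le> x}. real n powr (-lam))
        \<le> (\<Sum>p\<in>{p::nat. prime p \<and> real p \<le> x}. real p powr (-lam))"
      unfolding * excess_eq[symmetric] by simp
  qed
qed

lemma excess_nonpos_mono:
  assumes A: "\<And>n. n \<in> A \<Longrightarrow> n > 1" and le: "\<And>m. excess A m lam \<le> 0" and lm: "lam \<le> mu"
  shows "excess A m mu \<le> 0"
proof -
  define w where "w n = real n powr (lam - mu)" for n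
  define g where "g n = (of_bool (n \<in> A) - of_bool (prime n)) * real n powr (-lam)" for n
  have w_le: "w (Suc n) \<le> w n" if "n > 0" for n
    unfolding w_def using that lm by (intro powr_mono2') auto
  have w0: "w n \<ge> 0" for n by (simp add: w_def)
  have G: "sum g {..n} \<le> 0" for n using le[of n] by (simp add: excess_def g_def)
  have g0: "g 0 = 0" using A[of 0] by (auto simp: g_def)
  have "(\<Sum>n\<le>m. g n * w n) \<le> w m * sum g {..m}" for m
  proof (induction m)
    case (Suc m)
    have "w m * sum g {..m} \<le> w (Suc m) * sum g {..m}"
    proof (cases "m = 0")
      case False
      then show ?thesis using w_le[of m] G[of m] by (intro mult_right_mono_neg) auto
    qed (simp add: g0)
    with Suc show ?case by (simp add: algebra_simps)
  qed simp
  also have "w m * sum g {..m} \<le> 0" using w0[of m] G[of m] by (rule mult_nonneg_nonpos)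
  also have "(\<Sum>n\<le>m. g n * w n) = excess A m mu"
    unfolding excess_def g_def w_def
    by (intro sum.cong refl) (simp add: mult.assoc powr_add[symmetric])
  finally show ?thesis .
qed

lemma sum_inverse_squares_less_1: "(\<Sum>j=2..m. real j powr (-2)) \<le> 1"
proof -
  have "(\<Sum>j=2..m. real j powr (-2)) \<le> 1 - 1 / real m" if "m \<ge> 1" for m
    using that
  proof (induction m rule: dec_induct)
    case (step m)
    have "real (Suc m) powr (-2) = 1 / (real (Suc m))\<^sup>2"
      by (simp add: powr_minus powr_numeral divide_inverse)
    also have "\<dots> \<le> 1 / (real m * real (Suc m))"
      using step by (intro divide_left_mono) (auto simp: power2_eq_square)
    also have "\<dots> = 1 / real m - 1 / real (Suc m)"
      using step by (simp add: field_simps)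
    finally show ?case using step by simp
  qed simp
  from this[of m] show ?thesis by (cases "m = 0") (auto intro: order_trans)
qed

lemma prime_sum_dominates_2:
  assumes k: "k \<ge> 1"
  shows "prime_sum_dominates k 2"
  unfolding prime_sum_dominates_iff
proof (intro allI impI)
  fix A m assume A: "strongly_primitive k A"
  have gt1: "n > 1" if "n \<in> A" for n using A that by (auto simp: strongly_primitive_def)
  have prim: "a = b" if "a \<in> A" "b \<in> A" "a dvd b" for a b
  proof (rule ccontr)
    assume "a \<noteq> b"
    have "a dvd b ^ k" using that k by (meson dvd_power dvd_trans less_le_trans zero_less_one)
    then have "a dvd prod_list (replicate k b)" by (simp add: prod_list_replicate)
    moreover have "set (replicate k b) \<subseteq> A - {a}" using \<open>a \<noteq> b\<close> that by auto
    ultimately show False using A that(1) unfolding strongly_primitive_def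
      by (meson length_replicate)
  qed
  have "\<exists>p. prime p \<and> p dvd n" if "n \<in> A" for n
    using gt1[OF that] prime_factor_nat[of n] by auto
  then obtain q where q: "prime (q n)" "q n dvd n" if "n \<in> A" for n by metis
  define B where "B = {n\<in>A. n \<le> m}"
  define P where "P = {p. prime p \<and> p \<le> m}"
  have fin: "finite B" "finite P" by (auto simp: B_def P_def)
  have qP: "q ` B \<subseteq> P"
  proof clarify
    fix n assume "n \<in> B"
    then have n: "n \<in> A" "n \<le> m" by (auto simp: B_def)
    then have "q n \<le> n" using q(2)[of n] gt1[of n] by (intro dvd_imp_le) auto
    then show "q n \<in> P" using q(1)[of n] n by (auto simp: P_def)
  qed
  have fibre: "(\<Sum>n\<in>{n\<in>B. q n = p}. real n powr (-2)) \<le> real p powr (-2)" if p: "p \<in> P" for p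
  proof (cases "p \<in> A")
    case True
    have "{n\<in>B. q n = p} \<subseteq> {p}"
    proof
      fix n assume "n \<in> {n\<in>B. q n = p}"
      then have "n \<in> A" "p dvd n" using q(2) by (auto simp: B_def)
      then have "p = n" by (rule prim[OF True])
      then show "n \<in> {p}" by blast
    qed
    then have "(\<Sum>n\<in>{n\<in>B. q n = p}. real n powr (-2)) \<le> (\<Sum>n\<in>{p}. real n powr (-2))"
      by (intro sum_mono2) auto
    then show ?thesis by simp
  next
    case False
    have p0: "p > 0" using p by (auto simp: P_def intro: prime_gt_0_nat)
    have sub: "{n\<in>B. q n = p} \<subseteq> (\<lambda>j. p * j) ` {2..m}"
    proof
      fix n assume "n \<in> {n\<in>B. q n = p}"
      then have n: "n \<in> A" "n \<le> m" "q n = p" by (auto simp: B_def)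
      obtain j where j: "n = p * j" using q(2)[OF n(1)] n(3) by (auto elim: dvdE)
      have "j \<noteq> 0" using gt1[OF n(1)] j by (cases "j = 0") auto
      moreover have "j \<noteq> 1" using False n(1) j by auto
      moreover have "j \<le> m" using j n(2) p0 by (metis le_trans mult_le_mono1 nat_mult_1 Suc_leI One_nat_def)
      ultimately show "n \<in> (\<lambda>j. p * j) ` {2..m}" using j by auto
    qed
    have "(\<Sum>n\<in>{n\<in>B. q n = p}. real n powr (-2))
            \<le> (\<Sum>n\<in>(\<lambda>j. p * j) ` {2..m}. real n powr (-2))"
      using sub by (intro sum_mono2) auto
    also have "\<dots> = (\<Sum>j=2..m. real (p * j) powr (-2))"
      using p0 by (subst sum.reindex) (auto simp: inj_on_def)
    also have "\<dots> = real p powr (-2) * (\<Sum>j=2..m. real j powr (-2))"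
      by (simp add: sum_distrib_left powr_mult)
    also have "\<dots> \<le> real p powr (-2) * 1"
      by (intro mult_left_mono sum_inverse_squares_less_1) simp
    finally show ?thesis by simp
  qed
  have "(\<Sum>n\<in>B. real n powr (-2)) = (\<Sum>p\<in>P. \<Sum>n\<in>{n\<in>B. q n = p}. real n powr (-2))"
    using sum.group[OF fin qP, of "\<lambda>n. real n powr (-2)"] by simp
  also have "\<dots> \<le> (\<Sum>p\<in>P. real p powr (-2))"
    by (intro sum_mono fibre)
  finally show "excess A m 2 \<le> 0"
    unfolding excess_eq[symmetric] B_def P_def by simp
qed

lemma not_prime_sum_dominates:
  assumes k: "k \<ge> 1"
  shows "\<not> prime_sum_dominates k (-2)"
proof -
  have "strongly_primitive k {4}" using k by (auto simp: strongly_primitive_def)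
  moreover have "excess {4} 4 (-2) > 0"
  proof -
    have s: "{..4::nat} = {0,1,2,3,4}" by auto
    have "prime (2::nat)" "prime (3::nat)" by (simp_all add: prime_nat_numeral_eq)
    moreover have "\<not> prime (4::nat)" by (simp add: prime_nat_numeral_eq)
    ultimately show ?thesis
      unfolding excess_def s by (simp add: powr_numeral)
  qed
  ultimately show ?thesis unfolding prime_sum_dominates_iff by (meson not_less)
qed

lemma ex1_strong_critical_exponent:
  assumes k: "k \<ge> 1"
  shows "\<exists>!t. \<forall>lam. prime_sum_dominates k lam \<longleftrightarrow> lam \<ge> t"
proof -
  define S where "S = {lam. prime_sum_dominates k lam}"
  have mono: "mu \<in> S" if "lam \<in> S" "lam \<le> mu" for lam mu
    using that excess_nonpos_mono[OF _ _ that(2)]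
    unfolding S_def prime_sum_dominates_iff by (auto simp: strongly_primitive_def)
  have "S = (\<Inter>A\<in>{A. strongly_primitive k A}. \<Inter>m. {lam. excess A m lam \<le> 0})"
    by (auto simp: S_def prime_sum_dominates_iff)
  moreover have "closed {lam. excess A m lam \<le> 0}" for A m
  proof (rule closed_Collect_le)
    have "continuous_on UNIV (\<lambda>lam. real n powr (-lam))" for n
      by (cases "n = 0") (auto intro!: continuous_intros)
    then show "continuous_on UNIV (\<lambda>lam. excess A m lam)"
      unfolding excess_def by (intro continuous_on_sum continuous_on_mult continuous_on_const)
  qed simp
  ultimately have cl: "closed S" by auto
  have ne: "S \<noteq> {}" using prime_sum_dominates_2[OF k] by (auto simp: S_def)
  have bd: "bdd_below S"
  proof (rule bdd_belowI[of _ "-2"])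
    fix lam assume "lam \<in> S"
    then show "-2 \<le> lam" using mono[of lam "-2"] not_prime_sum_dominates[OF k]
      by (force simp: S_def)
  qed
  have "lam \<in> S \<longleftrightarrow> lam \<ge> Inf S" for lam
  proof
    assume "lam \<in> S"
    then show "Inf S \<le> lam" by (rule cInf_lower[OF _ bd])
  next
    assume "Inf S \<le> lam"
    then show "lam \<in> S" by (rule mono[OF closed_contains_Inf[OF ne bd cl]])
  qed
  moreover have "lam \<in> S \<longleftrightarrow> prime_sum_dominates k lam" for lam
    unfolding S_def by (rule mem_Collect_eq)
  ultimately have iff: "prime_sum_dominates k lam \<longleftrightarrow> lam \<ge> Inf S" for lam by metis
  show ?thesis
  proof (rule ex1I[of _ "Inf S"])
    fix t assume "\<forall>lam. prime_sum_dominates k lam \<longleftrightarrow> lam \<ge> t"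
    then have "lam \<ge> t \<longleftrightarrow> lam \<ge> Inf S" for lam using iff by metis
    then show "t = Inf S" by (meson antisym order_refl)
  qed (use iff in metis)
qed

lemma strong_critical_exponent_iff:
  assumes "k \<ge> 1"
  shows "prime_sum_dominates k lam \<longleftrightarrow> lam \<ge> strong_critical_exponent k"
  using theI'[OF ex1_strong_critical_exponent[OF assms]]
  unfolding strong_critical_exponent_def by blast

end

theory Submission
  imports Defs
begin

text \<open>
  Let \<open>A\<close> be strongly \<open>k\<close>-primitive.  Call a divisor \<open>d\<close> of \<open>a \<in> A\<close> covered if it divides another
  member of \<open>A\<close>, and private otherwise; a private divisor identifies the member it comes from.
  The comparison with the primes rests on choosing a private divisor for every member.

  If some prime power \<open>p ^ multiplicity p a\<close> is private, charge \<open>a\<close> to \<open>p\<close>.  No prime is charged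
  twice, because \<open>a\<close> alone has the largest multiplicity of \<open>p\<close>.  As \<open>p \<le> a\<close>, these members cost at
  most the terms \<open>p powr -lam\<close> of the primes that they use.

  The remaining members are fully covered: all their prime powers are covered.  Write such an \<open>a\<close>
  as a product of as few covered factors as possible.  There are more than \<open>k\<close> of them, since \<open>k\<close>
  covered factors would make \<open>a\<close> divide a product of \<open>k\<close> other members.  Merging the two
  smallest factors shortens the factorization, so their product \<open>d\<close> is private; and, being the two
  smallest out of at least \<open>k + 1\<close>, they satisfy \<open>d ^ (k + 1) \<le> a\<^sup>2\<close>
  (\<open>fully_covered_private_divisor\<close>).  The map from \<open>a\<close> to \<open>d\<close> is injective, and
  \<open>a powr -lam \<le> d powr -mu\<close> with \<open>mu = lam * (k + 1) / 2\<close>, an exponent so large that these members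
  cost very little.

  What pays for them is the following gain.  If a prime \<open>p\<close> divides a fully covered member \<open>e\<close>, a
  member charged to \<open>p\<close> contains \<open>p\<close> more often than \<open>e\<close> does, so it is at least \<open>p\<^sup>2\<close>.  Hence at
  least \<open>p powr -lam - p powr (-2 * lam)\<close> of the term of \<open>p\<close> is left over.  Sort the values \<open>d\<close> by
  their largest prime factor \<open>p\<close>.  Since \<open>d\<close> is not a prime power, \<open>d = p ^ j * m\<close> where \<open>m > 1\<close>
  has only prime factors below \<open>p\<close>, and the geometric series over \<open>j\<close> leaves one inequality for each
  prime \<open>p\<close> (\<open>prime_sum_dominatesI\<close>):
  the sum of \<open>m powr -mu\<close> is at most \<open>(p powr -lam - p powr (-2 * lam)) * (p powr mu - 1)\<close>.

  The right-hand side increases with \<open>p\<close>, so only small primes matter.  For \<open>k \<ge> 3\<close> and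
  \<open>lam = 3 * ln k / k\<close> one has \<open>mu \<ge> 2\<close>, the left-hand side is at most 1, and the right-hand side is at
  least 1 already at \<open>p = 3\<close>.  For \<open>k = 2\<close> the smaller exponent \<open>lam = 1 \<le> 3 * ln 2 / 2\<close> is
  good enough and turns the inequality into a numerical statement about \<open>mu = 3/2\<close>.
\<close>

section \<open>Private divisors\<close>

definition covered :: "nat set \<Rightarrow> nat \<Rightarrow> nat \<Rightarrow> bool" where
  "covered A a d \<longleftrightarrow> (\<exists>b\<in>A - {a}. d dvd b)"

definition fully_covered :: "nat set \<Rightarrow> nat \<Rightarrow> bool" where
  "fully_covered A a \<longleftrightarrow> (\<forall>p. prime p \<longrightarrow> p dvd a \<longrightarrow> covered A a (p ^ multiplicity p a))"

text \<open>Only smooth numbers above 1 are collected, because these are the cofactors of the largest prime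
  power in a number with at least two prime factors.  The cutoff \<open>N\<close> keeps the set finite.\<close>

definition smooth_below :: "nat \<Rightarrow> nat \<Rightarrow> nat set" where
  "smooth_below p N = {m. 1 < m \<and> m \<le> N \<and> (\<forall>q. prime q \<longrightarrow> q dvd m \<longrightarrow> q < p)}"

lemma powr_of_power:
  fixes x a :: real
  assumes "x > 0"
  shows "(x ^ n) powr a = x powr (real n * a)"
  using powr_powr[of x "real n" a] assms by (simp add: powr_realpow)

lemma powr_of_power':
  fixes x a :: real
  shows "x \<ge> 0 \<Longrightarrow> (x ^ n) powr a = (x powr a) ^ n"
  by (induction n) (simp_all add: powr_mult)

lemma power_length_le_prod_list_square:
  fixes c :: nat
  assumes "\<And>z. z \<in> set zs \<Longrightarrow> c \<le> z\<^sup>2"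
  shows "c ^ length zs \<le> (prod_list zs)\<^sup>2"
  using assms
proof (induction zs)
  case (Cons z zs)
  have "c * c ^ length zs \<le> z\<^sup>2 * (prod_list zs)\<^sup>2"
    using Cons by (intro mult_mono) auto
  then show ?case by (simp add: power_mult_distrib)
qed simp

text \<open>In a factorization of minimal length no two factors can be merged, so the product \<open>x * y\<close> of its
  two smallest factors violates \<open>C\<close>.  Every other factor \<open>z\<close> satisfies \<open>x * y \<le> z\<^sup>2\<close>; multiplying
  these bounds, together with \<open>(x * y)\<^sup>2\<close>, gives \<open>(x * y) ^ n \<le> a\<^sup>2\<close> for the length \<open>n > k\<close>.\<close>

lemma merge_two_smallest_factors:
  fixes C :: "nat \<Rightarrow> bool"
  assumes k: "k \<ge> 1" and a: "a > 0"
    and ex: "\<exists>gs. (\<forall>g\<in>set gs. C g) \<and> prod_list gs = a"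
    and long: "\<And>gs. (\<forall>g\<in>set gs. C g) \<Longrightarrow> prod_list gs = a \<Longrightarrow> length gs > k"
  shows "\<exists>d. d dvd a \<and> \<not> C d \<and> d ^ (k + 1) \<le> a\<^sup>2"
proof -
  define Q where "Q gs \<longleftrightarrow> (\<forall>g\<in>set gs. C g) \<and> prod_list gs = a" for gs
  obtain gs0 where gs0: "Q gs0" "\<And>hs. Q hs \<Longrightarrow> length gs0 \<le> length hs"
    using ex_has_least_nat[of Q _ length] ex unfolding Q_def by blast
  define gs where "gs = sort gs0"
  have "prod_list gs = prod_list gs0"
    unfolding gs_def prod_mset_prod_list[symmetric] by simp
  with gs0(1) have Q: "Q gs" by (auto simp: Q_def gs_def)
  have min: "length gs \<le> length hs" if "Q hs" for hs
    using gs0(2)[OF that] by (simp add: gs_def)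
  have "length gs > k" using long Q by (auto simp: Q_def)
  with k obtain x y zs where gs: "gs = x # y # zs"
    by (cases gs; cases "tl gs") auto
  have sorted: "sorted (x # y # zs)" unfolding gs[symmetric] by (simp add: gs_def)
  have prod: "x * y * prod_list zs = a" using Q by (simp add: Q_def gs mult.assoc)
  have "\<not> Q (x * y # zs)" using min[of "x * y # zs"] gs by auto
  then have "\<not> C (x * y)" using Q prod by (auto simp: Q_def gs)
  moreover have "x * y dvd a" using prod by (metis dvd_triv_left)
  moreover have "(x * y) ^ (k + 1) \<le> a\<^sup>2"
  proof -
    have "x * y > 0" using prod a by (cases "x * y = 0") auto
    then have "(x * y) ^ (k + 1) \<le> (x * y) ^ (length zs + 2)"
      using \<open>length gs > k\<close> gs by (intro power_increasing) auto
    also have "\<dots> = (x * y)\<^sup>2 * (x * y) ^ length zs"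
      unfolding power_add by (rule mult.commute)
    also have "\<dots> \<le> (x * y)\<^sup>2 * (prod_list zs)\<^sup>2"
    proof (intro mult_left_mono power_length_le_prod_list_square)
      fix z assume "z \<in> set zs"
      then show "x * y \<le> z\<^sup>2"
        using sorted unfolding power2_eq_square by (intro mult_mono) auto
    qed simp
    also have "\<dots> = a\<^sup>2" using prod by (simp add: power_mult_distrib[symmetric])
    finally show ?thesis .
  qed
  ultimately show ?thesis by blast
qed

text \<open>Being covered plays the role of \<open>C\<close>.  The prime powers of \<open>a\<close> provide one factorization into
  covered factors, and strong primitivity excludes the short ones.\<close>

lemma fully_covered_private_divisor:
  assumes A: "strongly_primitive k A" and k: "k \<ge> 1" and a: "a \<in> A" "fully_covered A a"
  shows "\<exists>d. d dvd a \<and> \<not> covered A a d \<and> d ^ (k + 1) \<le> a\<^sup>2"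
proof (rule merge_two_smallest_factors[OF k])
  have a1: "a > 1" using A a(1) by (auto simp: strongly_primitive_def)
  then show "a > 0" by simp
  obtain ps where ps: "set ps = prime_factors a" "distinct ps"
    using finite_distinct_list[of "prime_factors a"] by auto
  show "\<exists>gs. (\<forall>g\<in>set gs. covered A a g) \<and> prod_list gs = a"
  proof (intro exI conjI)
    let ?gs = "map (\<lambda>p. p ^ multiplicity p a) ps"
    show "\<forall>g\<in>set ?gs. covered A a g"
      using a(2) ps by (auto simp: fully_covered_def prime_factors_dvd)
    have "prod_list ?gs = (\<Prod>p\<in>prime_factors a. p ^ multiplicity p a)"
      using ps by (metis prod.distinct_set_conv_list)
    also have "\<dots> = a" using a1 prime_factorization_nat[of a] by simp
    finally show "prod_list ?gs = a" .
  qed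
  fix gs assume gs: "\<forall>g\<in>set gs. covered A a g" "prod_list gs = a"
  show "length gs > k"
  proof (rule ccontr)
    assume "\<not> length gs > k"
    then have len: "length gs \<le> k" by simp
    from gs(1) obtain f where f: "\<And>g. g \<in> set gs \<Longrightarrow> f g \<in> A - {a} \<and> g dvd f g"
      unfolding covered_def by metis
    have "gs \<noteq> []" using gs(2) a1 by auto
    then have hd: "f (hd gs) \<in> A - {a}" using f by simp
    \<comment> \<open>A member repeated as padding brings the number of factors up to exactly \<open>k\<close>.\<close>
    define bs where "bs = map f gs @ replicate (k - length gs) (f (hd gs))"
    have dvd: "prod_list gs' dvd prod_list (map f gs')" if "set gs' \<subseteq> set gs" for gs'
      using that f by (induction gs') (auto intro: mult_dvd_mono)
    have "length bs = k" using len by (simp add: bs_def)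
    moreover have "set bs \<subseteq> A - {a}" using f hd by (auto simp: bs_def)
    moreover have "a dvd prod_list bs"
      using dvd[of gs] gs(2) by (simp add: bs_def)
    ultimately show False using A a(1) unfolding strongly_primitive_def by blast
  qed
qed

text \<open>Any power of a prime \<open>p\<close> dividing \<open>a\<close> divides the full \<open>p\<close>-part of \<open>a\<close>, and that part is covered
  when \<open>a\<close> is fully covered.  A private divisor therefore has at least two distinct prime
  factors.\<close>

lemma fully_covered_private_divisor_not_prime_power:
  assumes "a > 0" "fully_covered A a" "d dvd a" "\<not> covered A a d" "prime p" "p dvd a"
  shows "d \<noteq> p ^ j"
proof
  assume d: "d = p ^ j"
  have "covered A a (p ^ multiplicity p a)" using assms by (auto simp: fully_covered_def)
  moreover have "d dvd p ^ multiplicity p a"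
    unfolding d using assms d by (intro le_imp_power_dvd multiplicity_geI) auto
  ultimately show False using assms(4) unfolding covered_def by (meson dvd_trans)
qed

section \<open>Comparison with the primes\<close>

lemma split_largest_prime:
  fixes d :: nat
  assumes "d > 1"
  obtains p j m where "prime p" "p dvd d" "d = p ^ j * m" "j \<ge> 1" "m > 0"
    "\<And>q. prime q \<Longrightarrow> q dvd m \<Longrightarrow> q < p"
proof -
  define p where "p = Max (prime_factors d)"
  have ne: "prime_factors d \<noteq> {}" using assms prime_factor_nat[of d] 
    by (auto simp: prime_factors_dvd)
  then have "p \<in> prime_factors d" unfolding p_def by (intro Max_in) auto
  then have p: "prime p" "p dvd d" by (auto simp: prime_factors_dvd)
  obtain m where m: "d = p ^ multiplicity p d * m" "\<not> p dvd m"
    using multiplicity_decompose'[of d p] assms p by (metis not_one_less_zero not_prime_unit)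
  have "q < p" if q: "prime q" "q dvd m" for q
  proof -
    have "q dvd d" using q m(1) by (metis dvd_mult)
    then have "q \<le> p" unfolding p_def using q assms
      by (intro Max_ge) (auto simp: prime_factors_dvd)
    moreover have "q \<noteq> p" using m(2) q by auto
    ultimately show ?thesis by simp
  qed
  moreover have "multiplicity p d \<ge> 1"
    using p assms by (simp add: Suc_le_eq prime_multiplicity_gt_zero_iff)
  moreover have "m > 0" using m(2) by (cases "m = 0") auto
  ultimately show ?thesis using that p m(1) by blast
qed

text \<open>The total weight of the numbers with largest prime factor \<open>p\<close> is bounded by a product of two
  independent sums, one over the exponent of \<open>p\<close> and one over the cofactor; the quotient
  \<open>1 / (p powr mu - 1)\<close> is the geometric series over all exponents \<open>j \<ge> 1\<close>.\<close>

lemma sum_fixed_largest_prime: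
  fixes mu :: real and p N :: nat
  assumes p: "prime p" and mu: "mu > 0" and D: "finite D"
    and dec: "\<And>d. d \<in> D \<Longrightarrow> \<exists>j m. d = p ^ j * m \<and> 1 \<le> j \<and> m \<in> smooth_below p N"
    and le: "\<And>d. d \<in> D \<Longrightarrow> d \<le> N"
  shows "(\<Sum>d\<in>D. real d powr (-mu)) \<le>
    (\<Sum>m\<in>smooth_below p N. real m powr (-mu)) / (real p powr mu - 1)"
proof -
  let ?S = "smooth_below p N"
  have finS: "finite ?S" by (rule finite_subset[of _ "{..N}"]) (auto simp: smooth_below_def)
  have p1: "p > 1" using p by (rule prime_gt_1_nat)
  define r where "r = real p powr (-mu)"
  have "real p powr mu > 1" using p1 mu by (intro gr_one_powr) auto
  then have r: "0 < r" "r < 1" by (auto simp: r_def powr_minus inverse_less_1_iff prime_gt_0_nat[OF p])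
  have "D \<subseteq> (\<lambda>(j,m). p ^ j * m) ` ({1..N} \<times> ?S)"
  proof
    fix d assume d: "d \<in> D"
    obtain j m where jm: "d = p ^ j * m" "1 \<le> j" "m \<in> ?S" using dec[OF d] by blast
    have "j < p ^ j" using p1 by (intro power_gt_expt) simp
    also have "\<dots> \<le> d" using jm by (auto simp: smooth_below_def)
    finally have "j \<le> N" using le[OF d] by simp
    with jm show "d \<in> (\<lambda>(j,m). p ^ j * m) ` ({1..N} \<times> ?S)" by force
  qed
  then have "(\<Sum>d\<in>D. real d powr (-mu))
      \<le> (\<Sum>d\<in>(\<lambda>(j,m). p ^ j * m) ` ({1..N} \<times> ?S). real d powr (-mu))"
    using finS by (intro sum_mono2) auto
  also have "\<dots> \<le> (\<Sum>(j,m)\<in>{1..N} \<times> ?S. r ^ j * real m powr (-mu))"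
  proof -
    have e: "real (p ^ j * m) powr (-mu) = r ^ j * real m powr (-mu)" for j m
      by (simp add: r_def powr_mult powr_of_power')
    show ?thesis
      using finS by (intro order_trans[OF sum_image_le]) (auto simp: e[symmetric] case_prod_beta)
  qed
  also have "\<dots> = (\<Sum>j=1..N. r ^ j) * (\<Sum>m\<in>?S. real m powr (-mu))"
    by (simp add: sum_product sum.cartesian_product)
  also have "\<dots> \<le> (r / (1 - r)) * (\<Sum>m\<in>?S. real m powr (-mu))"
  proof (intro mult_right_mono sum_nonneg)
    have "(\<Sum>j=1..N. r ^ j) = (r - r ^ Suc N) / (1 - r)"
      using r by (subst sum_gp) (auto)
    also have "\<dots> \<le> r / (1 - r)" using r by (intro divide_right_mono) auto
    finally show "(\<Sum>j=1..N. r ^ j) \<le> r / (1 - r)" .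
  qed auto
  also have "r / (1 - r) = 1 / (real p powr mu - 1)"
    using r p1 by (simp add: r_def powr_minus field_simps)
  finally show ?thesis by simp
qed

text \<open>The hypothesis says, prime by prime, that the private divisors with largest prime factor \<open>p\<close>
  weigh no more than what is left over of the term of \<open>p\<close>.  Only primes dividing a fully covered
  member have to pay, and exactly for these a saving is guaranteed.\<close>

lemma prime_sum_dominatesI:
  assumes k: "k \<ge> 1" and lam: "lam > 0" and mu: "mu = lam * real (k + 1) / 2"
    and cond: "\<And>p N. prime p \<Longrightarrow> (\<Sum>m\<in>smooth_below p N. real m powr (-mu))
        \<le> (real p powr (-lam) - real p powr (-2 * lam)) * (real p powr mu - 1)"
  shows "prime_sum_dominates k lam"
  unfolding prime_sum_dominates_iff
proof (intro allI impI)
  fix A and N :: nat assume A: "strongly_primitive k A"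
  have gt1: "n > 1" if "n \<in> A" for n using A that by (auto simp: strongly_primitive_def)
  have mu0: "mu > 0" using lam by (simp add: mu)
  define P where "P = {p. prime p \<and> p \<le> N}"
  define E where "E = {n\<in>A. n \<le> N \<and> fully_covered A n}"
  define F where "F = {n\<in>A. n \<le> N \<and> \<not> fully_covered A n}"
  define PE where "PE = {p\<in>P. \<exists>e\<in>E. p dvd e}"
  have fin: "finite P" "finite E" "finite F" "finite PE"
    by (auto simp: P_def E_def F_def PE_def)
  \<comment> \<open>An upper bound for the weight of a member charged to \<open>p\<close>.\<close>
  define h where "h p = (if p \<in> PE then real p powr (-2 * lam) else real p powr (-lam))" for p
  have F_bound: "(\<Sum>n\<in>F. real n powr (-lam)) \<le> (\<Sum>p\<in>P. h p)"
  proof -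
    have "\<forall>n\<in>F. \<exists>p. prime p \<and> p dvd n \<and> \<not> covered A n (p ^ multiplicity p n)"
      by (auto simp: F_def fully_covered_def)
    then obtain q where q: "\<And>n. n \<in> F \<Longrightarrow>
        prime (q n) \<and> q n dvd n \<and> \<not> covered A n (q n ^ multiplicity (q n) n)" by metis
    have less: "multiplicity (q n) b < multiplicity (q n) n" if "n \<in> F" "b \<in> A" "b \<noteq> n" for n b
    proof (rule ccontr)
      assume "\<not> ?thesis"
      then have "q n ^ multiplicity (q n) n dvd b"
        using multiplicity_dvd'[of "multiplicity (q n) n" "q n" b] by simp
      then show False using q[OF that(1)] that by (auto simp: covered_def)
    qed
    have inj: "inj_on q F"
    proof (rule inj_onI, rule ccontr)
      fix m n assume "m \<in> F" "n \<in> F" "q m = q n" "m \<noteq> n"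
      then show False using less[of m n] less[of n m] by (auto simp: F_def)
    qed
    have le: "real n powr (-lam) \<le> h (q n)" if n: "n \<in> F" for n
    proof -
      have q0: "q n > 0" using q[OF n] by (auto intro: prime_gt_0_nat)
      have n0: "n > 0" using n gt1 by (force simp: F_def)
      show ?thesis
      proof (cases "q n \<in> PE")
        case False
        have "q n \<le> n" using q[OF n] n0 by (auto intro: dvd_imp_le)
        then show ?thesis using False q0 lam by (auto simp: h_def intro!: powr_mono2')
      next
        case True
        then obtain e where e: "e \<in> E" "q n dvd e" by (auto simp: PE_def)
        then have eA: "e \<in> A" "e \<noteq> n" using n by (auto simp: E_def F_def)
        \<comment> \<open>The fully covered \<open>e\<close> already contains \<open>q n\<close> once, so \<open>n\<close> contains it twice.\<close>
        have "multiplicity (q n) e > 0"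
          using e q[OF n] gt1[OF eA(1)] by (simp add: prime_multiplicity_gt_zero_iff)
        then have "2 \<le> multiplicity (q n) n" using less[OF n eA] by simp
        then have "q n ^ 2 dvd n" by (rule multiplicity_dvd')
        then have "q n ^ 2 \<le> n" using n0 by (rule dvd_imp_le)
        then have "real n powr (-lam) \<le> real (q n ^ 2) powr (-lam)"
          using q0 lam by (intro powr_mono2') (auto simp del: of_nat_power)
        also have "\<dots> = real (q n) powr (-2 * lam)"
          using q0 by (simp add: powr_of_power)
        finally show ?thesis using True by (simp add: h_def)
      qed
    qed
    have "(\<Sum>n\<in>F. real n powr (-lam)) \<le> (\<Sum>n\<in>F. h (q n))" by (intro sum_mono le)
    also have "\<dots> = (\<Sum>p\<in>q ` F. h p)" using inj by (simp add: sum.reindex)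
    also have "\<dots> \<le> (\<Sum>p\<in>P. h p)"
    proof (rule sum_mono2[OF fin(1)])
      show "q ` F \<subseteq> P"
      proof clarify
        fix n assume n: "n \<in> F"
        then have "q n \<le> n" using q[OF n] gt1[of n] by (intro dvd_imp_le) (auto simp: F_def)
        then show "q n \<in> P" using q[OF n] n by (auto simp: P_def F_def)
      qed
    qed (auto simp: h_def)
    finally show ?thesis .
  qed
  have E_bound: "(\<Sum>n\<in>E. real n powr (-lam))
      \<le> (\<Sum>p\<in>PE. real p powr (-lam) - real p powr (-2 * lam))"
  proof -
    have "\<forall>n\<in>E. \<exists>d. d dvd n \<and> \<not> covered A n d \<and> d ^ (k + 1) \<le> n\<^sup>2"
      using fully_covered_private_divisor[OF A k] by (auto simp: E_def)
    then obtain d where d: "\<And>n. n \<in> E \<Longrightarrow> d n dvd n \<and> \<not> covered A n (d n) \<and> d n ^ (k + 1) \<le> n\<^sup>2"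
      by metis
    have inj: "inj_on d E"
    proof (rule inj_onI, rule ccontr)
      fix m n assume "m \<in> E" "n \<in> E" "d m = d n" "m \<noteq> n"
      then show False using d[of m] d[of n] by (auto simp: covered_def E_def)
    qed
    have "\<forall>n\<in>E. \<exists>p. p \<in> PE \<and> (\<exists>j m. d n = p ^ j * m \<and> 1 \<le> j \<and> m \<in> smooth_below p N)"
    proof
      fix n assume n: "n \<in> E"
      then have nA: "n \<in> A" "n > 1" "n \<le> N" "fully_covered A n" using gt1 by (auto simp: E_def)
      have dn: "d n dvd n" "\<not> covered A n (d n)" using d[OF n] by auto
      have "d n > 0" using dn nA by (cases "d n = 0") auto
      have np: "d n \<noteq> p ^ j" if "prime p" "p dvd n" for p j
        using nA dn that by (intro fully_covered_private_divisor_not_prime_power) auto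
      obtain r where r: "prime r" "r dvd n" using nA prime_factor_nat[of n] by auto
      have "d n \<noteq> 1" using np[OF r, of 0] by simp
      with \<open>d n > 0\<close> have "d n > 1" by simp
      then obtain p j m where pjm: "prime p" "p dvd d n" "d n = p ^ j * m" "j \<ge> 1" "m > 0"
          "\<And>q. prime q \<Longrightarrow> q dvd m \<Longrightarrow> q < p"
        by (rule split_largest_prime) blast
      have pn: "p dvd n" using pjm(2) dn(1) by (rule dvd_trans)
      have "m \<noteq> 1" using np[OF pjm(1) pn, of j] pjm(3) by auto
      moreover have "m dvd n" using pjm(3) dn(1) by (metis dvd_mult_right)
      then have "m \<le> N" using nA dvd_imp_le[of m n] by simp
      ultimately have "m \<in> smooth_below p N" using pjm by (auto simp: smooth_below_def)
      moreover have "p \<in> PE"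
        using pn n nA dvd_imp_le[of p n] pjm(1) by (auto simp: PE_def P_def)
      ultimately show "\<exists>p. p \<in> PE \<and> (\<exists>j m. d n = p ^ j * m \<and> 1 \<le> j \<and> m \<in> smooth_below p N)"
        using pjm by blast
    qed
    then obtain g where g: "\<And>n. n \<in> E \<Longrightarrow> g n \<in> PE \<and>
        (\<exists>j m. d n = g n ^ j * m \<and> 1 \<le> j \<and> m \<in> smooth_below (g n) N)"
      by metis
    have le: "real n powr (-lam) \<le> real (d n) powr (-mu)" if n: "n \<in> E" for n
    proof -
      have n0: "n > 0" using n gt1 by (force simp: E_def)
      then have d0: "d n > 0" using d[OF n] by (cases "d n = 0") auto
      have "real (d n) powr (-mu) = real (d n ^ (k + 1)) powr (-lam / 2)"
        using d0 unfolding of_nat_power by (subst powr_of_power) (simp_all add: mu mult.commute)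
      also have "\<dots> \<ge> real (n ^ 2) powr (-lam / 2)"
        using d[OF n] d0 lam by (intro powr_mono2') (auto simp del: of_nat_power power_Suc)
      also have "real (n ^ 2) powr (-lam / 2) = real n powr (-lam)"
        using n0 unfolding of_nat_power by (subst powr_of_power) simp_all
      finally show ?thesis .
    qed
    have "(\<Sum>n\<in>E. real n powr (-lam)) \<le> (\<Sum>n\<in>E. real (d n) powr (-mu))"
      by (intro sum_mono le)
    also have "\<dots> = (\<Sum>p\<in>PE. \<Sum>n\<in>{n\<in>E. g n = p}. real (d n) powr (-mu))"
      using g by (intro sum.group[symmetric] fin) auto
    also have "\<dots> \<le> (\<Sum>p\<in>PE. real p powr (-lam) - real p powr (-2 * lam))"
    proof (rule sum_mono)
      fix p assume p: "p \<in> PE"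
      let ?Ep = "{n\<in>E. g n = p}"
      have pp: "prime p" using p by (auto simp: PE_def P_def)
      have p1: "real p powr mu > 1" using prime_gt_1_nat[OF pp] mu0 by (intro gr_one_powr) auto
      have "(\<Sum>n\<in>?Ep. real (d n) powr (-mu)) = (\<Sum>x\<in>d ` ?Ep. real x powr (-mu))"
        using inj by (subst sum.reindex) (auto simp: inj_on_def)
      also have "\<dots> \<le> (\<Sum>m\<in>smooth_below p N. real m powr (-mu)) / (real p powr mu - 1)"
      proof (rule sum_fixed_largest_prime[OF pp mu0])
        show "finite (d ` ?Ep)" using fin by auto
        fix x assume "x \<in> d ` ?Ep"
        then obtain n where n: "n \<in> E" "g n = p" "x = d n" by auto
        show "\<exists>j m. x = p ^ j * m \<and> 1 \<le> j \<and> m \<in> smooth_below p N" using g[OF n(1)] n by auto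
        have "d n \<le> n" using d[OF n(1)] n gt1[of n] by (intro dvd_imp_le) (auto simp: E_def)
        then show "x \<le> N" using n by (auto simp: E_def)
      qed
      also have "\<dots> \<le> real p powr (-lam) - real p powr (-2 * lam)"
        using cond[OF pp] p1 by (simp add: pos_divide_le_eq)
      finally show "(\<Sum>n\<in>?Ep. real (d n) powr (-mu)) \<le> real p powr (-lam) - real p powr (-2 * lam)" .
    qed
    finally show ?thesis .
  qed
  have "(\<Sum>n\<in>{n\<in>A. n \<le> N}. real n powr (-lam))
      = (\<Sum>n\<in>F. real n powr (-lam)) + (\<Sum>n\<in>E. real n powr (-lam))"
    by (subst sum.union_disjoint[symmetric]) (auto simp: E_def F_def intro: sum.cong)
  also have "\<dots> \<le> (\<Sum>p\<in>P. h p) + (\<Sum>p\<in>PE. real p powr (-lam) - real p powr (-2 * lam))"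
    using F_bound E_bound by simp
  also have "(\<Sum>p\<in>PE. real p powr (-lam) - real p powr (-2 * lam))
      = (\<Sum>p\<in>P. if p \<in> PE then real p powr (-lam) - real p powr (-2 * lam) else 0)"
    using fin by (subst sum.inter_filter[symmetric]) (auto simp: PE_def intro: sum.cong)
  also have "(\<Sum>p\<in>P. h p) + \<dots> = (\<Sum>p\<in>P. real p powr (-lam))"
    by (subst sum.distrib[symmetric]) (auto simp: h_def intro!: sum.cong)
  finally show "excess A N lam \<le> 0" unfolding excess_eq[symmetric] P_def by simp
qed

section \<open>The inequality for \<open>k \<ge> 3\<close>\<close>

lemma smooth_below_subset: "smooth_below p N \<subseteq> {2..N}"
  by (auto simp: smooth_below_def)

lemma smooth_below_2: "smooth_below 2 N = {}"
proof -
  have False if "m \<in> smooth_below 2 N" for m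
  proof -
    from that obtain q where "prime q" "q dvd m"
      using prime_factor_nat[of m] by (auto simp: smooth_below_def)
    with that have "q < 2" "q \<ge> 2" using prime_ge_2_nat[of q] by (auto simp: smooth_below_def)
    then show False by simp
  qed
  then show ?thesis by blast
qed

text \<open>Rewritten as \<open>(1 - x powr -lam) * (x powr (mu - lam) - x powr -lam)\<close>, the bound is a product of
  two nonnegative increasing functions of \<open>x\<close>.\<close>

lemma gain_ratio_mono:
  fixes lam mu p q :: real
  assumes "0 < lam" "lam \<le> mu" "1 < q" "q \<le> p"
  shows "(q powr (-lam) - q powr (-2 * lam)) * (q powr mu - 1)
       \<le> (p powr (-lam) - p powr (-2 * lam)) * (p powr mu - 1)"
proof -
  have e: "(x powr (-lam) - x powr (-2 * lam)) * (x powr mu - 1)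
      = (1 - x powr (-lam)) * (x powr (mu - lam) - x powr (-lam))" if "x > 0" for x
    using that by (simp add: algebra_simps powr_add[symmetric])
  have "q powr (mu - lam) \<le> p powr (mu - lam)" using assms by (intro powr_mono2) auto
  moreover have "p powr (-lam) \<le> q powr (-lam)" using assms by (intro powr_mono2') auto
  moreover have "q powr (-lam) \<le> q powr 0" "q powr (-lam) \<le> q powr (mu - lam)"
    using assms by (auto simp del: powr_zero_eq_one intro!: powr_mono)
  ultimately show ?thesis using assms
    by (subst (1 2) e) (auto intro!: mult_mono)
qed

text \<open>At \<open>p = 2\<close> there are no cofactors.  From \<open>p = 3\<close> on, the cofactors contribute at most 1 because
  \<open>mu \<ge> 2\<close>, and by monotonicity it suffices that the right-hand side is at least 1 at 3.  Two crude
  estimates achieve this: \<open>3 powr (mu - lam) \<ge> k\<close>, from \<open>mu - lam = 3/2 * ln k * (1 - 1/k)\<close> and \<open>ln 3 \<ge> 1\<close>, and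
  \<open>1 - 3 powr -lam \<ge> lam / (1 + lam)\<close>; the product of \<open>lam / (1 + lam)\<close> and \<open>k - 1\<close> is at least 1.\<close>

lemma prime_sum_dominates_at_least_three:
  assumes k: "k \<ge> 3"
  shows "prime_sum_dominates k (3 * ln (real k) / real k)"
proof -
  define L where "L = ln (real k)"
  define lam where "lam = 3 * L / real k"
  define mu where "mu = lam * real (k + 1) / 2"
  have ln3: "ln 3 \<ge> (1::real)" using exp_le by (simp add: ln_ge_iff)
  have "ln 3 \<le> L" unfolding L_def using k by simp
  with ln3 have L1: "L \<ge> 1" by simp
  have lam0: "lam > 0" using L1 k by (simp add: lam_def)
  have mu_lam: "mu - lam = 3 / 2 * L * (1 - 1 / real k)" "mu = 3 / 2 * L * (1 + 1 / real k)"
    using k by (auto simp: mu_def lam_def field_simps)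
  have mu2: "mu \<ge> 2"
  proof (cases "k = 3")
    case True
    then show ?thesis using L1 by (simp add: mu_lam)
  next
    case False
    then have "ln 4 \<le> L" unfolding L_def using k by simp
    moreover have "ln (4::real) = 2 * ln 2" using ln_realpow[of 2 2] by simp
    ultimately have "4 / 3 \<le> L" using ln2_ge_two_thirds by simp
    moreover have "L * 1 \<le> L * (1 + 1 / real k)" using L1 by (intro mult_left_mono) auto
    moreover have "mu = 3 / 2 * (L * (1 + 1 / real k))" unfolding mu_lam by simp
    ultimately show ?thesis by linarith
  qed
  have kl: "real k \<le> 3 powr (mu - lam)"
  proof -
    have "1 - 1 / real k \<ge> 2 / 3" using k by (simp add: field_simps)
    then have "L * (2 / 3) * 1 \<le> L * (1 - 1 / real k) * ln 3" using L1 ln3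
      by (intro mult_mono) auto
    moreover have "(mu - lam) * ln 3 = 3 / 2 * (L * (1 - 1 / real k) * ln 3)"
      unfolding mu_lam(1) by (simp only: mult.assoc)
    ultimately have "L \<le> (mu - lam) * ln 3" by linarith
    then have "exp L \<le> exp ((mu - lam) * ln 3)" by (simp only: exp_le_cancel_iff)
    then show ?thesis using k by (simp add: powr_def L_def)
  qed
  have e3: "1 - 3 powr (-lam) \<ge> lam / (1 + lam)"
  proof -
    have "1 + lam \<le> exp lam" by (rule exp_ge_add_one_self)
    also have "\<dots> \<le> 3 powr lam" unfolding powr_def using ln3 lam0 by simp
    finally have "inverse (3 powr lam) \<le> inverse (1 + lam)" using lam0 by (intro le_imp_inverse_le) auto
    then show ?thesis using lam0 by (simp add: powr_minus field_simps)
  qed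
  have big: "1 \<le> (3 powr (-lam) - 3 powr (-2 * lam)) * (3 powr mu - 1)"
  proof -
    have "real k \<le> 3 * L * (real k - 2)"
    proof -
      have "real k \<le> 3 * (real k - 2)" using k by simp
      also have "\<dots> \<le> 3 * L * (real k - 2)" using L1 k by (intro mult_right_mono) auto
      finally show ?thesis .
    qed
    then have "1 \<le> lam / (1 + lam) * (real k - 1)"
      using k L1 by (simp add: lam_def field_simps)
    also have "\<dots> \<le> (1 - 3 powr (-lam)) * (3 powr (mu - lam) - 3 powr (-lam))"
    proof (rule mult_mono[OF e3])
      have "3 powr (-lam) \<le> 3 powr (0::real)" using lam0 by (intro powr_mono) auto
      then show "real k - 1 \<le> 3 powr (mu - lam) - 3 powr (-lam)" using kl by simp
      show "0 \<le> 1 - 3 powr (-lam)" using lam0 e3 by (smt (verit) divide_nonneg_nonneg)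
    qed (use k in auto)
    also have "\<dots> = (3 powr (-lam) - 3 powr (-2 * lam)) * (3 powr mu - 1)"
      by (simp add: algebra_simps powr_add[symmetric])
    finally show ?thesis .
  qed
  have "prime_sum_dominates k lam"
  proof (rule prime_sum_dominatesI[OF _ lam0 mu_def])
    fix p N :: nat assume p: "prime p"
    show "(\<Sum>m\<in>smooth_below p N. real m powr (-mu))
        \<le> (real p powr (-lam) - real p powr (-2 * lam)) * (real p powr mu - 1)"
    proof (cases "p = 2")
      case True
      have "(2::real) powr (-2 * lam) \<le> 2 powr (-lam)" using lam0 by (intro powr_mono) auto
      moreover have "(2::real) powr mu \<ge> 2 powr 0" using mu2 by (intro powr_mono) auto
      ultimately show ?thesis unfolding True smooth_below_2 by simp
    next
      case False
      then have p3: "p \<ge> 3" using prime_ge_2_nat[OF p] by simp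
      have "(\<Sum>m\<in>smooth_below p N. real m powr (-mu)) \<le> (\<Sum>m=2..N. real m powr (-mu))"
        by (intro sum_mono2 smooth_below_subset) auto
      also have "\<dots> \<le> (\<Sum>m=2..N. real m powr (-2))"
        using mu2 by (intro sum_mono powr_mono) auto
      also have "\<dots> \<le> 1" by (rule sum_inverse_squares_less_1)
      also note big
      also have "(3 powr (-lam) - 3 powr (-2 * lam)) * (3 powr mu - 1)
          \<le> (real p powr (-lam) - real p powr (-2 * lam)) * (real p powr mu - 1)"
        using p3 lam0 mu_lam L1 k by (intro gain_ratio_mono) (auto simp: mu_def field_simps)
      finally show ?thesis .
    qed
  qed (use k in simp)
  then show ?thesis by (simp add: lam_def L_def)
qed

section \<open>The inequality for \<open>k = 2\<close>\<close>

lemma powr_three_halves: "x \<ge> 0 \<Longrightarrow> x powr (3/2) = x * sqrt x"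
  using powr_add[of x 1 "1/2"] by (simp add: powr_half_sqrt)

text \<open>The right-hand side is the integral of \<open>x powr (-3/2)\<close> over the unit interval centred at \<open>m\<close>, so
  this is the midpoint rule for a convex function.  Writing \<open>u\<close> and \<open>v\<close> for the two square roots, the
  integral equals \<open>2 / (u * v * (u + v))\<close>, and \<open>u * v \<le> m\<close> and \<open>u + v \<le> 2 * sqrt m\<close>.\<close>

lemma three_halves_midpoint_bound:
  assumes "m \<ge> 1"
  shows "real m powr (-3/2) \<le> 2 / sqrt (real m - 1/2) - 2 / sqrt (real m + 1/2)"
proof -
  define x where "x = real m"
  have x: "x \<ge> 1" using assms by (simp add: x_def)
  define u v where "u = sqrt (x - 1/2)" and "v = sqrt (x + 1/2)"
  have uv: "u > 0" "v > 0" "u\<^sup>2 = x - 1/2" "v\<^sup>2 = x + 1/2" using x by (auto simp: u_def v_def)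
  have s: "0 \<le> (v - u)\<^sup>2" by simp
  have e: "(v - u)\<^sup>2 = 2 * x - 2 * (u * v)" "(u + v)\<^sup>2 = 2 * x + 2 * (u * v)"
    using uv(3,4) by (auto simp: power2_diff power2_sum)
  from s e have le: "u * v \<le> x" by simp
  have "(u + v)\<^sup>2 \<le> (2 * sqrt x)\<^sup>2" using e le x by (simp add: power_mult_distrib)
  then have "u + v \<le> 2 * sqrt x" by (rule power2_le_imp_le) (use x in simp)
  with le have "u * v * (u + v) \<le> x * (2 * sqrt x)" using uv x by (intro mult_mono) auto
  then have "2 / (x * (2 * sqrt x)) \<le> 2 / (u * v * (u + v))"
    using uv x by (intro divide_left_mono) auto
  also have "\<dots> = 2 * ((v - u) * (v + u)) / (u * v * (u + v))"
    using uv(3,4) by (simp add: algebra_simps power2_eq_square)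
  also have "\<dots> = 2 * (v - u) / (u * v)" using uv(1,2) by (simp add: add.commute)
  also have "\<dots> = 2 / u - 2 / v" using uv(1,2) by (simp add: field_simps)
  finally have "2 / (x * (2 * sqrt x)) \<le> 2 / u - 2 / v" .
  moreover have "x powr (-3/2) = 2 / (x * (2 * sqrt x))"
    using x powr_minus[of x "3/2"] by (simp add: powr_three_halves inverse_eq_divide)
  ultimately show ?thesis by (simp add: x_def u_def v_def)
qed

text \<open>The constant, about 1.629, is the value at \<open>p = 5\<close> of the right-hand side in
  \<open>prime_sum_dominatesI\<close> for \<open>lam = 1\<close> and \<open>mu = 3/2\<close>.  The infinite sum is about 1.612, so there is
  little room: comparison with an integral from 2, or with midpoints already from \<open>m = 2\<close>, would exceed
  it.  Taking the term at 2 exactly and midpoints from \<open>m = 3\<close> gives 1.619.\<close>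

lemma sum_three_halves_bound:
  "(\<Sum>m=2..N. real m powr (-3/2)) \<le> 4 / 25 * (5 * sqrt 5 - 1)"
proof -
  have tail: "(\<Sum>m=3..N. real m powr (-3/2)) \<le> 2 / sqrt (5/2) - 2 / sqrt (real N + 1/2)"
    if "N \<ge> 2" for N using that
  proof (induction N rule: dec_induct)
    case (step n)
    then show ?case using three_halves_midpoint_bound[of "Suc n"] by (simp add: algebra_simps)
  qed simp
  have s5: "sqrt 5 \<ge> 2.236" by (rule real_le_rsqrt) (simp add: power2_eq_square)
  have s2: "sqrt 2 \<ge> 1.414" by (rule real_le_rsqrt) (simp add: power2_eq_square)
  have s25: "sqrt (5/2) \<ge> 1.581" by (rule real_le_rsqrt) (simp add: power2_eq_square)
  show ?thesis
  proof (cases "N \<ge> 2")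
    case False
    then show ?thesis using s5 by simp
  next
    case True
    then have "(\<Sum>m=2..N. real m powr (-3/2)) = 2 powr (-3/2) + (\<Sum>m=3..N. real m powr (-3/2))"
      by (subst sum.atLeast_Suc_atMost) (auto simp: eval_nat_numeral)
    also have "\<dots> \<le> 2 powr (-3/2) + 2 / sqrt (5/2)"
    proof -
      have "2 / sqrt (real N + 1/2) \<ge> 0" by simp
      with tail[OF True] show ?thesis by linarith
    qed
    also have "(2::real) powr (-3/2) = 1 / (2 * sqrt 2)"
      using powr_minus[of "2::real" "3/2"] by (simp add: powr_three_halves inverse_eq_divide)
    also have "\<dots> \<le> 1 / 2.828" using s2 by (intro divide_left_mono) auto
    also have "2 / sqrt (5/2) \<le> 2 / 1.581" using s25 by (intro divide_left_mono) auto
    finally show ?thesis using s5 by simp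
  qed
qed

text \<open>The numbers above 1 with no prime factor from 3 on are the powers of 2.  At \<open>p = 3\<close> the sum
  over all \<open>m \<ge> 2\<close> would be too large, so this geometric series is needed instead.\<close>

lemma smooth_below_3_bound: "(\<Sum>m\<in>smooth_below 3 N. real m powr (-3/2)) \<le> 2/3"
proof -
  define r :: real where "r = 2 powr (-3/2)"
  have r: "r = 1 / (2 * sqrt 2)"
    using powr_minus[of "2::real" "3/2"] by (simp add: r_def powr_three_halves inverse_eq_divide)
  have s2: "sqrt 2 \<ge> 1.25" by (rule real_le_rsqrt) (simp add: power2_eq_square)
  have rle: "r \<le> 2/5" using s2 by (simp add: r field_simps)
  have r0: "r > 0" by (simp add: r_def)
  have sub: "smooth_below 3 N \<subseteq> (\<lambda>j. 2 ^ j) ` {1..N}"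
  proof
    fix m assume m: "m \<in> smooth_below 3 N"
    have "m > 1" using m by (auto simp: smooth_below_def)
    then obtain p j n where pjn: "prime p" "p dvd m" "m = p ^ j * n" "j \<ge> 1" "n > 0"
      "\<And>q. prime q \<Longrightarrow> q dvd n \<Longrightarrow> q < p" by (rule split_largest_prime) blast
    have "p < 3" using m pjn by (auto simp: smooth_below_def)
    then have p: "p = 2" using prime_ge_2_nat[OF pjn(1)] by simp
    have "n = 1"
    proof (rule ccontr)
      assume "n \<noteq> 1"
      then obtain q where "prime q" "q dvd n" using prime_factor_nat by blast
      then show False using pjn(6)[of q] prime_ge_2_nat[of q] p by simp
    qed
    then have mj: "m = 2 ^ j" using pjn p by simp
    have "j < m" unfolding mj by simp
    then have "j \<le> N" using m by (auto simp: smooth_below_def)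
    then show "m \<in> (\<lambda>j. 2 ^ j) ` {1..N}" using mj pjn by auto
  qed
  have "(\<Sum>m\<in>smooth_below 3 N. real m powr (-3/2)) \<le> (\<Sum>m\<in>(\<lambda>j. 2 ^ j) ` {1..N}. real m powr (-3/2))"
    using sub by (intro sum_mono2) auto
  also have "\<dots> = (\<Sum>j=1..N. r ^ j)"
    by (subst sum.reindex)
      (auto simp: inj_on_def r_def powr_of_power' intro!: sum.cong)
  also have "\<dots> = (r - r ^ Suc N) / (1 - r)" using rle by (subst sum_gp) auto
  also have "\<dots> \<le> r / (1 - r)" using rle r0 by (intro divide_right_mono) auto
  also have "\<dots> \<le> 2/3" using rle by (simp add: field_simps)
  finally show ?thesis .
qed

text \<open>At \<open>p = 3\<close> the right-hand side is about 0.93, which exceeds \<open>2/3\<close>; from \<open>p = 5\<close> on the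
  estimate over all integers is small enough.\<close>

lemma prime_sum_dominates_two_at_one: "prime_sum_dominates 2 1"
proof (rule prime_sum_dominatesI[where mu = "3/2"])
  fix p N :: nat assume p: "prime p"
  have ratio: "(real q powr (-1) - real q powr (-2 * 1)) * (real q powr (3/2) - 1)
      = (1 / real q - 1 / (real q)\<^sup>2) * (real q * sqrt (real q) - 1)" if "q > 0" for q :: nat
  proof -
    have "real q powr (-1) = 1 / real q" "real q powr (-2 * 1) = 1 / (real q)\<^sup>2"
      using that powr_minus[of "real q" 1] powr_minus[of "real q" 2]
      by (simp_all add: inverse_eq_divide)
    then show ?thesis by (simp only: powr_three_halves of_nat_0_le_iff)
  qed
  have mono: "(real q powr (-1) - real q powr (-2 * 1)) * (real q powr (3/2) - 1)
      \<le> (real p powr (-1) - real p powr (-2 * 1)) * (real p powr (3/2) - 1)"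
    if "q > 1" "q \<le> p" for q
    using that by (intro gain_ratio_mono) auto
  have "p = 2 \<or> p = 3 \<or> p \<ge> 5"
  proof -
    have "p \<noteq> 4" using p by (auto simp: prime_nat_numeral_eq)
    then show ?thesis using prime_ge_2_nat[OF p] by linarith
  qed
  then consider "p = 2" | "p = 3" | "p \<ge> 5" by blast
  then have "(\<Sum>m\<in>smooth_below p N. real m powr (-3/2))
      \<le> (real p powr (-1) - real p powr (-2 * 1)) * (real p powr (3/2) - 1)"
  proof cases
    case 1
    have "2 * sqrt 2 \<ge> (1::real)" using real_sqrt_ge_1_iff[of 2] by linarith
    then show ?thesis unfolding ratio[OF prime_gt_0_nat[OF p]] unfolding 1 smooth_below_2 by simp
  next
    case 2
    have "sqrt 3 \<ge> 1.7" by (rule real_le_rsqrt) (simp add: power2_eq_square)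
    then have "2/3 \<le> (1 / real 3 - 1 / (real 3)\<^sup>2) * (real 3 * sqrt (real 3) - 1)"
      by (simp add: power2_eq_square)
    with smooth_below_3_bound[of N] show ?thesis
      unfolding ratio[OF prime_gt_0_nat[OF p]] unfolding 2 by linarith
  next
    case 3
    have "(\<Sum>m\<in>smooth_below p N. real m powr (-3/2)) \<le> (\<Sum>m=2..N. real m powr (-3/2))"
      by (intro sum_mono2 smooth_below_subset) auto
    also have "\<dots> \<le> 4 / 25 * (5 * sqrt 5 - 1)" by (rule sum_three_halves_bound)
    also have "\<dots> = (1 / real 5 - 1 / (real 5)\<^sup>2) * (real 5 * sqrt (real 5) - 1)"
      by (simp add: power2_eq_square)
    also have "\<dots> \<le> (real p powr (-1) - real p powr (-2 * 1)) * (real p powr (3/2) - 1)"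
      using mono[of 5] 3 by (simp only: ratio)
    finally show ?thesis .
  qed
  then show "(\<Sum>m\<in>smooth_below p N. real m powr (-(3/2)))
      \<le> (real p powr (-1) - real p powr (-2 * 1)) * (real p powr (3/2) - 1)"
    by simp
qed auto

theorem theorem4:
  fixes k :: nat
  assumes "k \<ge> 2"
  shows "strong_critical_exponent k \<le> 3 * ln (real k) / real k"
proof (cases "k = 2")
  case True
  have "strong_critical_exponent 2 \<le> 1"
    using prime_sum_dominates_two_at_one strong_critical_exponent_iff[of 2 1] by simp
  also have "1 \<le> 3 * ln 2 / (2::real)" using ln2_ge_two_thirds by simp
  finally show ?thesis using True by simp
next
  case False
  then have "prime_sum_dominates k (3 * ln (real k) / real k)"
    using assms by (intro prime_sum_dominates_at_least_three) simp
  then show ?thesis using assms by (subst (asm) strong_critical_exponent_iff) auto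
qed

end
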